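(* Let $E\subset\mathbb{R}^n$ be a closed non-empty set and suppose there exists $\alpha>0$ such that $\operatorname{dist}(\cdot,E)^{-\alpha}\in A_p$ for some $1<p<\infty$. Then there exist positive constants $\sigma=\sigma(\alpha,p)$ (depending only on $\alpha,p$) and $C_0=C_0(n,\alpha,p,[\operatorname{dist}(\cdot,E)^{-\alpha}]_{A_p})$ (depending only on the listed quantities) such that $$\mathcal{L}_{Q_0}(t)\leq\frac{C_0}{t^\sigma}\,\mathcal{S}_{Q_0}(t)$$ for every cube $Q_0\subset\mathbb{R}^n$ intersecting $E$ and every $t\in(0,1)$.
   Context: $|A|$ is the Lebesgue measure of $A$. A cube in $\mathbb{R}^n$ is a half-open set $Q=[a_1,b_1)\times\cdots\times[a_n,b_n)$ with $b_i-a_i>0$ the same for all $i$; this common value is the side length $l(Q)$. For a cube $Q_0$, $\mathcal{D}(Q_0)=\bigcup_{j\geq0}\mathcal{D}^j(Q_0)$, where $\mathcal{D}^j(Q_0)$ is the family of $2^{jn}$ pairwise disjoint cubes of side length $2^{-j}l(Q_0)$ whose union is $Q_0$. For $Q\in\mathcal{D}^j(Q_0)$ with $j\geq1$, $\pi Q$ is the unique cube of $\mathcal{D}^{j-1}(Q_0)$ containing $Q$. Define $\mathcal{D}_E(Q_0)=\{Q\in\mathcal{D}(Q_0): Q\cap\overline{E}=\emptyset,\ \pi Q\cap\overline{E}\neq\emptyset\}$. For a set $E$ with $|\overline{E}|=0$, a cube $Q_0$ intersecting $\overline{E}$ and $t\in(0,1)$, put $$\mathcal{L}_{Q_0}(t)=\max\Big\{L\geq0:\sum_{Q\in\mathcal{D}_E(Q_0),\,l(Q)\geq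 L}\tfrac{|Q|}{|Q_0|}\geq t\Big\},\qquad \mathcal{S}_{Q_0}(t)=\min\Big\{L\geq0:\sum_{Q\in\mathcal{D}_E(Q_0),\,l(Q)\leq L}\tfrac{|Q|}{|Q_0|}\geq t\Big\}$$ (these exist and are positive). Under the hypotheses of the claim one has $|E|=0$, since $\operatorname{dist}(\cdot,E)^{-\alpha}=+\infty$ on $E$ and weights are locally integrable, so these functions are defined. $\operatorname{dist}(x,E)=\inf_{e\in E}|x-e|$. A weight is a locally integrable function $w$ on $\mathbb{R}^n$ with $w>0$ a.e. For $1<p<\infty$, $w\in A_p$ means that $w$ is a weight and there is $C>0$ with $\left(\frac{1}{|Q|}\int_Q w\right)\left(\frac{1}{|Q|}\int_Q w^{-\frac{1}{p-1}}\right)^{p-1}\leq C$ for every cube $Q$; the smallest such $C$ is denoted $[w]_{A_p}$. *)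

theory Defs
  imports "HOL-Analysis.Analysis"
begin

(* The exponent \<sigma> depends on \<alpha> and p only, so the dimension n has to be quantified after it and
   cannot be a type. R^n is therefore the product {..<n} \<rightarrow>\<^sub>E UNIV of n copies of the real line: the
   common carrier of the product topology and of the product measure below. *)

type_synonym point = "nat \<Rightarrow> real"

definition Rn :: "nat \<Rightarrow> point set" where
  "Rn n = ({..<n} \<rightarrow>\<^sub>E UNIV)"

definition Rn_topology :: "nat \<Rightarrow> point topology" where
  "Rn_topology n = product_topology (\<lambda>_. euclideanreal) {..<n}"

definition Rn_lebesgue :: "nat \<Rightarrow> point measure" where
  "Rn_lebesgue n = completion (Pi\<^sub>M {..<n} (\<lambda>_. lborel))"

lemma topspace_Rn_topology: "topspace (Rn_topology n) = Rn n"
  by (simp add: Rn_topology_def Rn_def)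

lemma space_Rn_lebesgue: "space (Rn_lebesgue n) = Rn n"
  by (simp add: Rn_lebesgue_def Rn_def space_PiM)

definition Rn_dist :: "nat \<Rightarrow> point \<Rightarrow> point \<Rightarrow> real" where
  "Rn_dist n x y = L2_set (\<lambda>i. x i - y i) {..<n}"

definition dist_to_set :: "nat \<Rightarrow> point set \<Rightarrow> point \<Rightarrow> real" where
  "dist_to_set n E x = (INF e\<in>E. Rn_dist n x e)"


definition cube :: "nat \<Rightarrow> point \<Rightarrow> real \<Rightarrow> point set" where
  "cube n a l = (\<Pi>\<^sub>E i\<in>{..<n}. {a i ..< a i + l})"

definition is_cube :: "nat \<Rightarrow> point set \<Rightarrow> bool" where
  "is_cube n Q \<longleftrightarrow> (\<exists>a l. 0 < l \<and> Q = cube n a l)"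

definition side_length :: "nat \<Rightarrow> point set \<Rightarrow> real" where
  "side_length n Q = (THE l. 0 < l \<and> (\<exists>a. Q = cube n a l))"

(* dyadic_gen n j Q0 is D^j(Q0), written out as the grid of subcubes. The lemmas dyadic_gen_* below
   show that these are 2^(j n) pairwise disjoint cubes of side length 2^(-j) l(Q0) with union Q0. *)
definition dyadic_gen :: "nat \<Rightarrow> nat \<Rightarrow> point set \<Rightarrow> point set set" where
  "dyadic_gen n j Q0 = {cube n (\<lambda>i. a i + real (k i) * (l / 2 ^ j)) (l / 2 ^ j) | a l k.
     0 < l \<and> Q0 = cube n a l \<and> (\<forall>i<n. k i < 2 ^ j)}"

definition dyadic_parent :: "nat \<Rightarrow> point set \<Rightarrow> point set \<Rightarrow> point set" where
  "dyadic_parent n Q0 Q =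
     (THE P. \<exists>j. Q \<in> dyadic_gen n (Suc j) Q0 \<and> P \<in> dyadic_gen n j Q0 \<and> Q \<subseteq> P)"

(* The parent exists only from the first generation on, hence the index Suc j. *)
definition dyadic_exterior :: "nat \<Rightarrow> point set \<Rightarrow> point set \<Rightarrow> point set set" where
  "dyadic_exterior n E Q0 = {Q \<in> (\<Union>j. dyadic_gen n (Suc j) Q0).
     Q \<inter> (Rn_topology n closure_of E) = {} \<and>
     dyadic_parent n Q0 Q \<inter> (Rn_topology n closure_of E) \<noteq> {}}"

definition large_scale :: "nat \<Rightarrow> point set \<Rightarrow> point set \<Rightarrow> real \<Rightarrow> real" where
  "large_scale n E Q0 t = (GREATEST L. 0 \<le> L \<and>
     t \<le> (\<Sum>\<^sub>\<infinity>Q\<in>{Q \<in> dyadic_exterior n E Q0. L \<le> side_length n Q}.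
            measure (Rn_lebesgue n) Q / measure (Rn_lebesgue n) Q0))"

definition small_scale :: "nat \<Rightarrow> point set \<Rightarrow> point set \<Rightarrow> real \<Rightarrow> real" where
  "small_scale n E Q0 t = (LEAST L. 0 \<le> L \<and>
     t \<le> (\<Sum>\<^sub>\<infinity>Q\<in>{Q \<in> dyadic_exterior n E Q0. side_length n Q \<le> L}.
            measure (Rn_lebesgue n) Q / measure (Rn_lebesgue n) Q0))"


(* Real powers of extended nonnegative numbers, with 0 and \<infinity> exchanged by negative exponents; in
   particular dist(x,E)^(-\<alpha>) = \<infinity> at points of E, whereas 0 powr (-\<alpha>) = 0 on the reals. *)
definition ennreal_powr :: "ennreal \<Rightarrow> real \<Rightarrow> ennreal" where
  "ennreal_powr x s =
     (if s = 0 then 1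
      else if x = 0 then (if s < 0 then \<infinity> else 0)
      else if x = \<infinity> then (if s < 0 then 0 else \<infinity>)
      else ennreal (enn2real x powr s))"

(* Weights take values in [0,\<infinity>]; local integrability makes them finite almost everywhere. *)
definition weight :: "nat \<Rightarrow> (point \<Rightarrow> ennreal) \<Rightarrow> bool" where
  "weight n w \<longleftrightarrow>
     w \<in> borel_measurable (Rn_lebesgue n) \<and>
     (\<forall>K. compactin (Rn_topology n) K \<longrightarrow> (\<integral>\<^sup>+x\<in>K. w x \<partial>Rn_lebesgue n) < \<infinity>) \<and>
     (AE x in Rn_lebesgue n. 0 < w x)"

definition average :: "nat \<Rightarrow> point set \<Rightarrow> (point \<Rightarrow> ennreal) \<Rightarrow> ennreal" where
  "average n Q w = (\<integral>\<^sup>+x\<in>Q. w x \<partial>Rn_lebesgue n) / emeasure (Rn_lebesgue n) Q"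

definition Ap_bound :: "nat \<Rightarrow> real \<Rightarrow> (point \<Rightarrow> ennreal) \<Rightarrow> real \<Rightarrow> bool" where
  "Ap_bound n p w C \<longleftrightarrow> 0 < C \<and> (\<forall>Q. is_cube n Q \<longrightarrow>
     average n Q w *
       ennreal_powr (average n Q (\<lambda>x. ennreal_powr (w x) (- 1 / (p - 1)))) (p - 1)
     \<le> ennreal C)"

definition Ap_weight :: "nat \<Rightarrow> real \<Rightarrow> (point \<Rightarrow> ennreal) \<Rightarrow> bool" where
  "Ap_weight n p w \<longleftrightarrow> weight n w \<and> (\<exists>C. Ap_bound n p w C)"

definition Ap_constant :: "nat \<Rightarrow> real \<Rightarrow> (point \<Rightarrow> ennreal) \<Rightarrow> real" where
  "Ap_constant n p w = (LEAST C. Ap_bound n p w C)"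

definition dist_weight :: "nat \<Rightarrow> point set \<Rightarrow> real \<Rightarrow> point \<Rightarrow> ennreal" where
  "dist_weight n E \<alpha> x = ennreal_powr (ennreal (dist_to_set n E x)) (- \<alpha>)"


lemma cube_eq_iff:
  assumes "0 < l" "0 < l'"
  shows "cube n a l = cube n b l' \<longleftrightarrow> (\<forall>i<n. a i = b i \<and> l = l')"
proof -
  have "{a i..<a i + l} = {b i..<b i + l'} \<longleftrightarrow> a i = b i \<and> l = l'" for i
    using assms by (auto simp: Ico_eq_Ico)
  moreover have "cube n a l = cube n b l' \<longleftrightarrow> (\<forall>i\<in>{..<n}. {a i..<a i + l} = {b i..<b i + l'})"
    unfolding cube_def using assms by (intro PiE_eq_iff_not_empty) auto
  ultimately show ?thesis by auto
qed

lemma side_length_cube: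
  assumes "0 < n" "0 < l"
  shows "side_length n (cube n a l) = l"
  unfolding side_length_def using assms by (intro the_equality) (auto simp: cube_eq_iff)

lemma dyadic_gen_cube:
  assumes "0 < n" "0 < l"
  shows "dyadic_gen n j (cube n a l) =
    (\<lambda>k. cube n (\<lambda>i. a i + real (k i) * (l / 2 ^ j)) (l / 2 ^ j)) ` ({..<n} \<rightarrow>\<^sub>E {..<2 ^ j})"
    (is "_ = ?c ` _")
proof (intro set_eqI iffI)
  fix Q assume "Q \<in> dyadic_gen n j (cube n a l)"
  then obtain a' l' k where Q: "Q = cube n (\<lambda>i. a' i + real (k i) * (l' / 2 ^ j)) (l' / 2 ^ j)"
    and *: "0 < l'" "cube n a l = cube n a' l'" "\<forall>i<n. k i < 2 ^ j"
    unfolding dyadic_gen_def by blast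
  have **: "\<forall>i<n. a i = a' i" "l = l'" using * assms by (auto simp: cube_eq_iff)
  have "Q = ?c (restrict k {..<n})"
    unfolding Q cube_def using ** by (intro PiE_cong) auto
  moreover have "restrict k {..<n} \<in> {..<n} \<rightarrow>\<^sub>E {..<2 ^ j}" using * by auto
  ultimately show "Q \<in> ?c ` ({..<n} \<rightarrow>\<^sub>E {..<2 ^ j})" by blast
next
  fix Q assume "Q \<in> ?c ` ({..<n} \<rightarrow>\<^sub>E {..<2 ^ j})"
  then obtain k where "k \<in> {..<n} \<rightarrow>\<^sub>E {..<2 ^ j}" "Q = ?c k" by blast
  moreover from this have "\<forall>i<n. k i < 2 ^ j" by (auto dest: PiE_mem)
  ultimately show "Q \<in> dyadic_gen n j (cube n a l)"
    unfolding dyadic_gen_def using assms by blast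
qed

lemma floor_cell_iff:
  assumes "0 < (h :: real)"
  shows "x \<in> {a + real m * h ..< a + real m * h + h} \<longleftrightarrow> \<lfloor>(x - a) / h\<rfloor> = int m"
proof -
  have "\<lfloor>(x - a) / h\<rfloor> = int m \<longleftrightarrow> real m \<le> (x - a) / h \<and> (x - a) / h < real m + 1"
    by (simp add: floor_eq_iff)
  also have "\<dots> \<longleftrightarrow> real m * h \<le> x - a \<and> x - a < (real m + 1) * h"
    using assms by (simp add: pos_le_divide_eq pos_divide_less_eq)
  also have "\<dots> \<longleftrightarrow> x \<in> {a + real m * h ..< a + real m * h + h}"
    by (auto simp: algebra_simps)
  finally show ?thesis by simp
qed

lemma dyadic_gen_side_length:
  assumes "0 < n" "is_cube n Q0" "Q \<in> dyadic_gen n j Q0"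
  shows "is_cube n Q \<and> side_length n Q = side_length n Q0 / 2 ^ j"
proof -
  obtain a l where Q0: "0 < l" "Q0 = cube n a l" using assms unfolding is_cube_def by blast
  then obtain b where "Q = cube n b (l / 2 ^ j)" using assms by (auto simp: dyadic_gen_cube)
  with Q0 assms show ?thesis by (auto simp: side_length_cube is_cube_def intro!: exI[of _ "l / 2 ^ j"])
qed

lemma dyadic_gen_card:
  assumes "0 < n" "is_cube n Q0"
  shows "card (dyadic_gen n j Q0) = 2 ^ (j * n)"
proof -
  obtain a l where Q0: "0 < l" "Q0 = cube n a l" using assms unfolding is_cube_def by blast
  have "inj_on (\<lambda>k. cube n (\<lambda>i. a i + real (k i) * (l / 2 ^ j)) (l / 2 ^ j)) ({..<n} \<rightarrow>\<^sub>E {..<2 ^ j})"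
    using Q0 by (intro inj_onI PiE_ext) (auto simp: cube_eq_iff)
  then show ?thesis using assms Q0 by (simp add: dyadic_gen_cube card_image card_PiE power_mult)
qed

lemma dyadic_gen_disjoint:
  assumes "0 < n" "is_cube n Q0"
  shows "disjoint (dyadic_gen n j Q0)"
proof (rule disjointI)
  fix P Q assume PQ: "P \<in> dyadic_gen n j Q0" "Q \<in> dyadic_gen n j Q0" "P \<noteq> Q"
  obtain a l where Q0: "0 < l" "Q0 = cube n a l" using assms unfolding is_cube_def by blast
  let ?h = "l / 2 ^ j"
  have h: "0 < ?h" using Q0 by simp
  obtain k m where k: "k \<in> {..<n} \<rightarrow>\<^sub>E {..<2 ^ j}" "P = cube n (\<lambda>i. a i + real (k i) * ?h) ?h"
    and m: "m \<in> {..<n} \<rightarrow>\<^sub>E {..<2 ^ j}" "Q = cube n (\<lambda>i. a i + real (m i) * ?h) ?h"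
    using PQ assms Q0 by (auto simp: dyadic_gen_cube)
  show "P \<inter> Q = {}"
  proof (rule ccontr)
    assume "P \<inter> Q \<noteq> {}"
    then obtain x where x: "x \<in> P" "x \<in> Q" by blast
    have "k i = m i" if "i < n" for i
    proof -
      have "x i \<in> {a i + real (k i) * ?h ..< a i + real (k i) * ?h + ?h}"
        using x k that unfolding cube_def by blast
      moreover have "x i \<in> {a i + real (m i) * ?h ..< a i + real (m i) * ?h + ?h}"
        using x m that unfolding cube_def by blast
      ultimately show ?thesis using floor_cell_iff[OF h] by (metis of_nat_eq_iff)
    qed
    then have "P = Q" using k m h by (simp add: cube_eq_iff)
    with PQ show False by blast
  qed
qed

lemma dyadic_gen_Union:
  assumes "0 < n" "is_cube n Q0"
  shows "\<Union> (dyadic_gen n j Q0) = Q0"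
proof -
  obtain a l where Q0: "0 < l" "Q0 = cube n a l" using assms unfolding is_cube_def by blast
  define h where "h = l / 2 ^ j"
  have h: "0 < h" and l: "2 ^ j * h = l" using Q0 by (simp_all add: h_def)
  have "cube n (\<lambda>i. a i + real (k i) * h) h \<subseteq> Q0" if k: "k \<in> {..<n} \<rightarrow>\<^sub>E {..<2 ^ j}" for k
    unfolding Q0 cube_def
  proof (intro PiE_mono)
    fix i assume "i \<in> {..<n}"
    then have "k i < 2 ^ j" using k by auto
    then have "real (k i) + 1 \<le> 2 ^ j"
      by (metis Suc_leI of_nat_Suc of_nat_le_iff of_nat_numeral of_nat_power add.commute)
    then have "(real (k i) + 1) * h \<le> l" using mult_right_mono[of "real (k i) + 1" "2 ^ j" h] h l by simp
    then have "real (k i) * h + h \<le> l" by (simp only: distrib_right mult_1)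
    moreover have "0 \<le> real (k i) * h" using h by (intro mult_nonneg_nonneg) simp_all
    ultimately show "{a i + real (k i) * h ..< a i + real (k i) * h + h} \<subseteq> {a i ..< a i + l}"
      unfolding ivl_subset by linarith
  qed
  moreover have "x \<in> \<Union> (dyadic_gen n j Q0)" if x: "x \<in> Q0" for x
  proof -
    define k where "k = (\<lambda>i\<in>{..<n}. nat \<lfloor>(x i - a i) / h\<rfloor>)"
    have r: "0 \<le> \<lfloor>(x i - a i) / h\<rfloor> \<and> \<lfloor>(x i - a i) / h\<rfloor> < 2 ^ j" if "i < n" for i
    proof -
      have "x i \<in> {a i ..< a i + l}" using x that unfolding Q0 cube_def by blast
      then have xi: "a i \<le> x i" "x i < a i + l" by simp_all
      then have "(x i - a i) / h < 2 ^ j" using h l by (simp add: pos_divide_less_eq)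
      with xi h show ?thesis by (simp add: floor_less_iff)
    qed
    have "k \<in> {..<n} \<rightarrow>\<^sub>E {..<2 ^ j}" using r by (auto simp: k_def nat_less_iff)
    moreover have "x \<in> cube n (\<lambda>i. a i + real (k i) * h) h"
      unfolding cube_def
    proof (intro PiE_I)
      fix i assume i: "i \<in> {..<n}"
      then have "\<lfloor>(x i - a i) / h\<rfloor> = int (k i)" using r by (simp add: k_def)
      then show "x i \<in> {a i + real (k i) * h ..< a i + real (k i) * h + h}"
        by (simp only: floor_cell_iff[OF h])
    next
      fix i assume "i \<notin> {..<n}"
      then show "x i = undefined" using x PiE_arb unfolding Q0 cube_def by fast
    qed
    ultimately show ?thesis using assms Q0 by (auto simp: dyadic_gen_cube h_def)
  qed
  ultimately show ?thesis using assms Q0 by (auto simp: dyadic_gen_cube h_def)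
qed

end

theory Submission
  imports Defs
begin

text \<open>
  Put \<open>w = dist(\<cdot>,E)\<^sup>-\<^sup>\<alpha>\<close>, and let \<open>L\<close> and \<open>S\<close> be the large and the small scale of \<open>Q0\<close> at level \<open>t\<close>.
  A cube \<open>Q\<close> of the exterior family with \<open>l(Q) \<le> S\<close> lies in a parent that meets \<open>E\<close>, so \<open>w \<ge> (2nS)\<^sup>-\<^sup>\<alpha>\<close> on
  \<open>Q\<close>; these cubes fill at least a fraction \<open>t\<close> of \<open>Q0\<close>. On the concentric half of a cube with \<open>l(Q) \<ge> L\<close> the
  distance to \<open>E\<close> is at least \<open>L/4\<close>, and these halves fill at least a fraction \<open>2\<^sup>-\<^sup>nt\<close>. The \<open>A\<^sub>p\<close> condition on \<open>Q0\<close> itself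
  therefore gives \<open>t\<^sup>p (L/(8nS))\<^sup>\<alpha> \<le> 2 powr (n(p-1)) \<cdot> [w]\<close>, so \<open>\<sigma> = p/\<alpha>\<close> works.
\<close>

section \<open>Measure of cubes\<close>

text \<open>Countable additivity of \<open>measure\<close> is available along sequences, whereas the
  two scales use unordered sums over families of cubes. An infinite countable \<open>I\<close> is
  enumerated bijectively, and nonnegative terms turn the convergent series into an unordered sum; a
  finite \<open>I\<close> admits no such enumeration and is treated apart.\<close>

lemma infsum_measure_disjoint:
  assumes I: "countable I" and X: "\<And>i. i \<in> I \<Longrightarrow> X i \<in> sets M" "disjoint_family_on X I"
    and fin: "emeasure M (\<Union>i\<in>I. X i) \<noteq> \<infinity>"
  shows "(\<Sum>\<^sub>\<infinity>i\<in>I. measure M (X i)) = measure M (\<Union>i\<in>I. X i)"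
proof (cases "finite I")
  case True
  have "emeasure M (X i) \<noteq> \<infinity>" if "i \<in> I" for i
  proof -
    have "(\<Union>i\<in>I. X i) \<in> sets M" using I X by (intro sets.countable_UN') auto
    moreover have "X i \<subseteq> (\<Union>i\<in>I. X i)" using that by blast
    ultimately show ?thesis using emeasure_mono[of "X i" _ M] fin by (metis infinity_ennreal_def top_unique)
  qed
  then have "measure M (\<Union>i\<in>I. X i) = (\<Sum>i\<in>I. measure M (X i))"
    using True X by (intro measure_finite_Union) auto
  then show ?thesis using True by simp
next
  case False
  define g where "g = from_nat_into I"
  have bij: "bij_betw g UNIV I"
    unfolding g_def using I False by (rule bij_betw_from_nat_into)
  then have rng: "range g = I" and inj: "inj g" by (auto simp: bij_betw_def)
  then have UN: "(\<Union>k. X (g k)) = (\<Union>i\<in>I. X i)" by blast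
  have "disjoint_family (\<lambda>k. X (g k))"
    unfolding disjoint_family_on_def
    using X(2) inj rng by (metis disjoint_family_onD injD rangeI)
  then have "(\<lambda>k. measure M (X (g k))) sums measure M (\<Union>k. X (g k))"
    using X(1) fin rng UN by (intro measure_UNION) auto
  then have "((\<lambda>k. measure M (X (g k))) has_sum measure M (\<Union>i\<in>I. X i)) UNIV"
    unfolding UN by (intro sums_nonneg_imp_has_sum) auto
  then have "(\<Sum>\<^sub>\<infinity>k\<in>UNIV. measure M (X (g k))) = measure M (\<Union>i\<in>I. X i)" by (rule infsumI)
  then show ?thesis using infsum_reindex_bij_betw[OF bij, of "\<lambda>i. measure M (X i)"] by simp
qed

lemma cube_sets [measurable]: "cube n a l \<in> sets (Rn_lebesgue n)"
proof -
  have "cube n a l \<in> sets (Pi\<^sub>M {..<n} (\<lambda>_. lborel))"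
    unfolding cube_def by (intro sets_PiM_I_finite) auto
  then show ?thesis unfolding Rn_lebesgue_def by simp
qed

lemma emeasure_cube:
  assumes "0 \<le> l"
  shows "emeasure (Rn_lebesgue n) (cube n a l) = ennreal (l ^ n)"
proof -
  interpret product_sigma_finite "\<lambda>_::nat. lborel :: real measure" ..
  have "cube n a l \<in> sets (Pi\<^sub>M {..<n} (\<lambda>_. lborel))"
    unfolding cube_def by (intro sets_PiM_I_finite) auto
  then have "emeasure (Rn_lebesgue n) (cube n a l) = emeasure (Pi\<^sub>M {..<n} (\<lambda>_. lborel)) (cube n a l)"
    unfolding Rn_lebesgue_def by simp
  also have "\<dots> = (\<Prod>i<n. emeasure lborel {a i ..< a i + l})"
    unfolding cube_def by (intro emeasure_PiM) auto
  also have "\<dots> = ennreal (l ^ n)" using assms by (simp add: ennreal_power)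
  finally show ?thesis .
qed

lemma measure_cube: "0 \<le> l \<Longrightarrow> measure (Rn_lebesgue n) (cube n a l) = l ^ n"
  by (simp add: measure_def emeasure_cube)

lemma corner_in_cube: "0 < l \<Longrightarrow> restrict a {..<n} \<in> cube n a l"
  by (auto simp: cube_def)

text \<open>The predicate \<open>weight\<close> states local integrability over compact sets only. A
  half-open cube is not compact, so the integral over it is controlled through the closed
  box.\<close>

lemma cube_subset_compact:
  obtains K where "compactin (Rn_topology n) K" "cube n a l \<subseteq> K"
proof
  show "compactin (Rn_topology n) (\<Pi>\<^sub>E i\<in>{..<n}. {a i .. a i + l})"
    unfolding Rn_topology_def by (auto simp: compactin_PiE)
  show "cube n a l \<subseteq> (\<Pi>\<^sub>E i\<in>{..<n}. {a i .. a i + l})"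
    unfolding cube_def by (intro PiE_mono) auto
qed

text \<open>A Chebyshev-type bound: the integral over \<open>Q\<close> is at least \<open>c\<close>
  times the measure of \<open>U\<close>, and \<open>U\<close> fills at least the fraction
  \<open>s\<close> of \<open>Q\<close>. Both averages in the \<open>A_p\<close> product are bounded
  below in this way.\<close>

lemma average_ge:
  assumes Q: "is_cube n Q" and U: "U \<in> sets (Rn_lebesgue n)" "U \<subseteq> Q"
    and mU: "s * measure (Rn_lebesgue n) Q \<le> measure (Rn_lebesgue n) U"
    and c: "0 \<le> c" "\<And>x. x \<in> U \<Longrightarrow> ennreal c \<le> f x" and s: "0 \<le> s"
  shows "ennreal (s * c) \<le> average n Q f"
proof -
  let ?M = "Rn_lebesgue n"
  obtain a l where l: "0 < l" "Q = cube n a l" using Q unfolding is_cube_def by blast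
  have eQ: "emeasure ?M Q = ennreal (l ^ n)" and mQ: "measure ?M Q = l ^ n"
    using l by (simp_all add: emeasure_cube measure_cube)
  have "emeasure ?M U \<le> emeasure ?M Q" using U l by (intro emeasure_mono) auto
  then have eU: "emeasure ?M U = ennreal (measure ?M U)"
    by (intro emeasure_eq_ennreal_measure) (auto simp: eQ top_unique)
  have "ennreal (s * c) * ennreal (l ^ n) = ennreal (c * (s * l ^ n))"
    using s c l by (simp add: ennreal_mult[symmetric] mult_ac)
  also have "\<dots> \<le> ennreal (c * measure ?M U)"
    using mU c by (intro ennreal_leI mult_left_mono) (auto simp: mQ)
  also have "\<dots> = (\<integral>\<^sup>+x. ennreal c * indicator U x \<partial>?M)"
    using U c by (simp add: nn_integral_cmult_indicator eU ennreal_mult)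
  also have "\<dots> \<le> (\<integral>\<^sup>+x\<in>Q. f x \<partial>?M)"
    using U c by (intro nn_integral_mono) (auto simp: indicator_def)
  finally have "ennreal (s * c) * ennreal (l ^ n) / ennreal (l ^ n) \<le> average n Q f"
    unfolding average_def eQ by (rule divide_right_mono_ennreal)
  moreover have "ennreal (s * c) * ennreal (l ^ n) / ennreal (l ^ n) = ennreal (s * c)"
    using l s c by (simp add: ennreal_mult[symmetric] divide_ennreal)
  ultimately show ?thesis by simp
qed

section \<open>The exterior dyadic cubes\<close>

text \<open>In each coordinate the cell containing a point is given by the floor of its scaled
  offset. The index at the coarser generation \<open>i\<close> is the index at generation
  \<open>j\<close> divided by 2^(j-i) and rounded down, so points sharing a fine cell also share the
  coarse one.\<close>

lemma dyadic_gen_nested: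
  assumes "0 < n" "is_cube n Q0" "Q \<in> dyadic_gen n j Q0" "P \<in> dyadic_gen n i Q0" "i \<le> j" "Q \<inter> P \<noteq> {}"
  shows "Q \<subseteq> P"
proof
  fix y assume y: "y \<in> Q"
  obtain a l where Q0: "0 < l" "Q0 = cube n a l" using assms unfolding is_cube_def by blast
  define h where "h j = l / 2 ^ j" for j :: nat
  have h: "0 < h j" for j using Q0 by (simp add: h_def)
  obtain k m where k: "Q = cube n (\<lambda>r. a r + real (k r) * h j) (h j)"
    and m: "P = cube n (\<lambda>r. a r + real (m r) * h i) (h i)"
    using assms Q0 unfolding h_def by (auto simp: dyadic_gen_cube)
  obtain x where x: "x \<in> Q" "x \<in> P" using assms by blast
  have fl: "\<lfloor>z / h i\<rfloor> = \<lfloor>z / h j\<rfloor> div 2 ^ (j - i)" for z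
  proof -
    have "(2::real) ^ j = 2 ^ (j - i) * 2 ^ i" using assms(5) by (simp flip: power_add)
    then have "z / h i = (z / h j) / real_of_int (2 ^ (j - i))"
      using Q0 by (simp add: h_def field_simps)
    then show ?thesis by (simp only: floor_divide_real_eq_div zero_le_power zero_le_numeral)
  qed
  show "y \<in> P"
    unfolding m cube_def
  proof (rule PiE_I)
    fix r assume r: "r \<in> {..<n}"
    have "x r \<in> {a r + real (k r) * h j ..< a r + real (k r) * h j + h j}"
      "y r \<in> {a r + real (k r) * h j ..< a r + real (k r) * h j + h j}"
      "x r \<in> {a r + real (m r) * h i ..< a r + real (m r) * h i + h i}"
      using x y r unfolding k m cube_def by blast+
    then have "\<lfloor>(x r - a r) / h j\<rfloor> = int (k r)" "\<lfloor>(y r - a r) / h j\<rfloor> = int (k r)"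
      "\<lfloor>(x r - a r) / h i\<rfloor> = int (m r)"
      by (simp_all only: floor_cell_iff[OF h])
    then have "\<lfloor>(y r - a r) / h i\<rfloor> = int (m r)" by (simp add: fl)
    then show "y r \<in> {a r + real (m r) * h i ..< a r + real (m r) * h i + h i}"
      by (simp only: floor_cell_iff[OF h])
  next
    fix r assume "r \<notin> {..<n}"
    then show "y r = undefined" using y PiE_arb unfolding k cube_def by fast
  qed
qed

lemma is_cube_nonempty: "is_cube n Q \<Longrightarrow> Q \<noteq> {}"
  unfolding is_cube_def using corner_in_cube by blast

text \<open>The description of the parent quantifies over the generation as well. The side length of
  \<open>Q\<close> determines that generation, and within one generation two distinct cubes cannot
  both contain the nonempty \<open>Q\<close>.\<close>

lemma dyadic_parent_eq:
  assumes "0 < n" "is_cube n Q0" "Q \<in> dyadic_gen n (Suc j) Q0" "P \<in> dyadic_gen n j Q0" "Q \<subseteq> P"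
  shows "dyadic_parent n Q0 Q = P"
  unfolding dyadic_parent_def
proof (rule the_equality)
  show "\<exists>j. Q \<in> dyadic_gen n (Suc j) Q0 \<and> P \<in> dyadic_gen n j Q0 \<and> Q \<subseteq> P"
    using assms by blast
next
  fix P' assume "\<exists>j. Q \<in> dyadic_gen n (Suc j) Q0 \<and> P' \<in> dyadic_gen n j Q0 \<and> Q \<subseteq> P'"
  then obtain i where i: "Q \<in> dyadic_gen n (Suc i) Q0" "P' \<in> dyadic_gen n i Q0" "Q \<subseteq> P'" by blast
  obtain a l where Q0: "0 < l" "Q0 = cube n a l" using assms unfolding is_cube_def by blast
  then have "side_length n Q0 = l" using assms by (simp add: side_length_cube)
  moreover have "side_length n Q0 / 2 ^ Suc i = side_length n Q0 / 2 ^ Suc j"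
    using dyadic_gen_side_length assms i by metis
  ultimately have "i = j" using Q0 by (simp add: power_inject_exp)
  then have "P \<inter> P' = {} \<or> P = P'"
    using dyadic_gen_disjoint[OF assms(1,2), of j] i assms by (auto simp: disjoint_def)
  moreover have "Q \<noteq> {}"
    using dyadic_gen_side_length assms is_cube_nonempty by metis
  ultimately show "P' = P" using assms(5) i(3) by blast
qed

section \<open>The exterior cubes as a partition of \<open>Q0\<close> minus \<open>E\<close>\<close>

locale exterior_cubes =
  fixes n :: nat and E Q0 :: "point set"
  assumes n: "0 < n" and Q0: "is_cube n Q0" and E: "closedin (Rn_topology n) E"
    and meets: "Q0 \<inter> E \<noteq> {}"
begin

abbreviation "\<D> \<equiv> dyadic_exterior n E Q0"
abbreviation "side \<equiv> side_length n"
abbreviation "M \<equiv> Rn_lebesgue n"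

lemma closure_E: "Rn_topology n closure_of E = E"
  using E by (simp add: closure_of_closedin)

lemma side_pos: "is_cube n Q \<Longrightarrow> 0 < side Q"
  unfolding is_cube_def using n by (auto simp: side_length_cube)

lemma cube_side: "is_cube n Q \<Longrightarrow> \<exists>a. Q = cube n a (side Q)"
  unfolding is_cube_def using n by (auto simp: side_length_cube)

lemma cube_measure: "is_cube n Q \<Longrightarrow> measure M Q = side Q ^ n"
  using cube_side[of Q] side_pos[of Q] measure_cube by (metis less_imp_le)

text \<open>Here the definite description of the parent is replaced by an actual cube: the
  generation \<open>j\<close> cube through a point of \<open>Q\<close> contains \<open>Q\<close> by
  nesting, hence is its parent.\<close>

lemma exteriorE:
  assumes "Q \<in> \<D>"
  obtains j P where "Q \<in> dyadic_gen n (Suc j) Q0" "P \<in> dyadic_gen n j Q0" "Q \<subseteq> P"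
    "Q \<inter> E = {}" "P \<inter> E \<noteq> {}" "is_cube n Q" "side Q = side Q0 / 2 ^ Suc j"
    "is_cube n P" "side P = 2 * side Q"
proof -
  obtain j where j: "Q \<in> dyadic_gen n (Suc j) Q0" "Q \<inter> E = {}" "dyadic_parent n Q0 Q \<inter> E \<noteq> {}"
    using assms unfolding dyadic_exterior_def closure_E by blast
  have Q: "is_cube n Q" "side Q = side Q0 / 2 ^ Suc j"
    using dyadic_gen_side_length[OF n Q0 j(1)] by auto
  obtain x where x: "x \<in> Q" using is_cube_nonempty[OF Q(1)] by blast
  then have "x \<in> \<Union> (dyadic_gen n j Q0)"
    using j(1) dyadic_gen_Union[OF n Q0] by blast
  then obtain P where P: "P \<in> dyadic_gen n j Q0" "x \<in> P" by blast
  have sub: "Q \<subseteq> P" using dyadic_gen_nested[OF n Q0 j(1) P(1)] x P by auto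
  have "is_cube n P" "side P = 2 * side Q"
    using dyadic_gen_side_length[OF n Q0 P(1)] Q by auto
  then show ?thesis
    using that[of j P] j P sub Q dyadic_parent_eq[OF n Q0 j(1) P(1) sub] by auto
qed

lemma exterior_gen: "Q \<in> \<D> \<Longrightarrow> \<exists>j. Q \<in> dyadic_gen n (Suc j) Q0"
  by (auto simp: dyadic_exterior_def)

lemma exterior_free: "Q \<in> \<D> \<Longrightarrow> Q \<inter> E = {}"
  by (auto simp: dyadic_exterior_def closure_E)

lemma exterior_is_cube: "Q \<in> \<D> \<Longrightarrow> is_cube n Q"
  by (erule exteriorE)

lemma exterior_subset: "Q \<in> \<D> \<Longrightarrow> Q \<subseteq> Q0"
  using dyadic_gen_Union[OF n Q0] exterior_gen by blast

text \<open>Exterior cubes are maximal among the dyadic cubes missing \<open>E\<close>. If a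
  strictly finer exterior cube \<open>B\<close> met an exterior cube \<open>A\<close>, then the
  parent of \<open>B\<close> would lie inside \<open>A\<close> and so miss \<open>E\<close>, which a
  parent never does.\<close>

lemma exterior_disjoint: "disjoint \<D>"
proof (rule disjointI)
  fix Q Q' assume *: "Q \<in> \<D>" "Q' \<in> \<D>" "Q \<noteq> Q'"
  have aux: "A = B" if A: "A \<in> \<D>" "A \<in> dyadic_gen n (Suc i) Q0" and B: "B \<in> \<D>" "B \<in> dyadic_gen n (Suc j) Q0"
    and "i \<le> j" and x: "x \<in> A" "x \<in> B" for A B i j x
  proof (cases "i = j")
    case True
    then show ?thesis using dyadic_gen_disjoint[OF n Q0, of "Suc j"] that by (auto simp: disjoint_def)
  next
    case False
    from B(1) obtain m P where P: "B \<in> dyadic_gen n (Suc m) Q0" "P \<in> dyadic_gen n m Q0" "B \<subseteq> P"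
      "B \<inter> E = {}" "P \<inter> E \<noteq> {}" "is_cube n B" "side B = side Q0 / 2 ^ Suc m"
      "is_cube n P" "side P = 2 * side B"
      by (rule exteriorE)
    have "side B = side Q0 / 2 ^ Suc j" using B dyadic_gen_side_length[OF n Q0] by blast
    \<comment> \<open>Comparing side lengths puts the parent \<open>P\<close> in generation
      \<open>j\<close>; since \<open>i < j\<close> gives \<open>Suc i \<le> j\<close>, it is no
      coarser than \<open>A\<close> and nesting applies.\<close>
    with P(7) have "m = j" using side_pos[OF Q0] by (simp add: power_inject_exp)
    then have "P \<subseteq> A" using dyadic_gen_nested[OF n Q0 P(2) A(2)] False that P by auto
    moreover have "A \<inter> E = {}" using A(1) exterior_free by blast
    ultimately show ?thesis using P(5) by blast
  qed
  obtain i j where "Q \<in> dyadic_gen n (Suc i) Q0" "Q' \<in> dyadic_gen n (Suc j) Q0"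
    using * exterior_gen by meson
  then show "Q \<inter> Q' = {}" using aux[of Q i Q' j] aux[of Q' j Q i] * linear[of i j] by blast
qed

lemma exterior_countable: "countable \<D>"
proof -
  have "countable (dyadic_gen n j Q0)" for j
    using dyadic_gen_card[OF n Q0, of j] by (intro countable_finite card_ge_0_finite) simp
  then have "countable (\<Union>j. dyadic_gen n (Suc j) Q0)" by blast
  then show ?thesis by (rule countable_subset[rotated]) (auto simp: dyadic_exterior_def)
qed

text \<open>A stopping-time argument. Around a point off the closed set \<open>E\<close>,
  sufficiently fine dyadic cubes miss \<open>E\<close>, while the cube of generation 0 is
  \<open>Q0\<close> and meets it. Where the cubes through the point first miss \<open>E\<close>, the
  cube is exterior.\<close>

lemma exterior_covers: "Q0 - \<Union>\<D> = Q0 \<inter> E"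
proof
  show "Q0 \<inter> E \<subseteq> Q0 - \<Union>\<D>" by (use exterior_free in blast)
  show "Q0 - \<Union>\<D> \<subseteq> Q0 \<inter> E"
  proof
    fix x assume "x \<in> Q0 - \<Union>\<D>"
    then have x: "x \<in> Q0" "x \<notin> \<Union>\<D>" by simp_all
    have gen: "\<exists>Q\<in>dyadic_gen n j Q0. x \<in> Q" for j
      using x dyadic_gen_Union[OF n Q0, of j] by blast
    show "x \<in> Q0 \<inter> E"
    proof (rule ccontr)
      assume "x \<notin> Q0 \<inter> E"
      moreover have "x \<in> topspace (Rn_topology n)"
        using x(1) Q0 by (auto simp: topspace_Rn_topology Rn_def is_cube_def cube_def)
      ultimately have "x \<in> topspace (Rn_topology n) - E" using x by blast
      moreover have "openin (Rn_topology n) (topspace (Rn_topology n) - E)"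
        using E by (rule openin_diff[OF openin_topspace])
      ultimately have "\<exists>U. finite {i \<in> {..<n}. U i \<noteq> topspace euclideanreal} \<and>
          (\<forall>i\<in>{..<n}. openin euclideanreal (U i)) \<and> x \<in> Pi\<^sub>E {..<n} U \<and>
          Pi\<^sub>E {..<n} U \<subseteq> topspace (Rn_topology n) - E"
        unfolding Rn_topology_def openin_product_topology_alt by (rule bspec[rotated])
      then obtain U where U: "\<forall>i<n. open (U i)" "x \<in> Pi\<^sub>E {..<n} U"
        "Pi\<^sub>E {..<n} U \<subseteq> topspace (Rn_topology n) - E"
        by (auto simp del: topspace_product_topology)
      have "\<forall>\<^sub>F e in at_right 0. \<forall>y. dist y (x i) < e \<longrightarrow> y \<in> U i" if "i < n" for i
      proof -
        have "x i \<in> U i" "open (U i)" using U(1,2) that by auto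
        then obtain e where e: "0 < e" "ball (x i) e \<subseteq> U i" by (meson openE)
        then have "\<forall>y. dist y (x i) < e' \<longrightarrow> y \<in> U i" if "e' < e" for e'
          using that by (force simp: dist_commute)
        then show ?thesis using e(1) unfolding eventually_at_right_field by blast
      qed
      \<comment> \<open>Only finitely many coordinates occur, so one radius serves all of them; as
        the dyadic sides tend to 0 from above, a single generation \<open>j\<close> is then fine
        enough.\<close>
      then have "\<forall>\<^sub>F e in at_right 0. \<forall>i\<in>{..<n}. \<forall>y. dist y (x i) < e \<longrightarrow> y \<in> U i"
        by (intro eventually_ball_finite) auto
      moreover have "filterlim (\<lambda>j. side Q0 / 2 ^ j) (at_right 0) sequentially"
      proof -
        have "(\<lambda>j. side Q0 / 2 ^ j) \<longlonglongrightarrow> 0"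
          using tendsto_mult_right[OF LIMSEQ_power_zero[of "1/2::real"], of "side Q0"]
          by (simp add: power_divide)
        then show ?thesis using side_pos[OF Q0] by (auto simp: filterlim_at)
      qed
      ultimately have "\<forall>\<^sub>F j in sequentially. \<forall>i\<in>{..<n}. \<forall>y. dist y (x i) < side Q0 / 2 ^ j \<longrightarrow> y \<in> U i"
        by (rule eventually_compose_filterlim)
      then obtain j where j: "\<forall>i<n. \<forall>y. dist y (x i) < side Q0 / 2 ^ j \<longrightarrow> y \<in> U i"
        by (auto simp: eventually_sequentially)
      define free where "free j \<longleftrightarrow> (\<exists>Q\<in>dyadic_gen n j Q0. x \<in> Q \<and> Q \<inter> E = {})" for j
      have "free j"
      proof -
        obtain Q where Q: "Q \<in> dyadic_gen n j Q0" "x \<in> Q" using gen by blast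
        then have "is_cube n Q" "side Q = side Q0 / 2 ^ j" using dyadic_gen_side_length[OF n Q0] by auto
        then obtain b where b: "Q = cube n b (side Q0 / 2 ^ j)" using cube_side[of Q] by auto
        have "Q \<subseteq> Pi\<^sub>E {..<n} U"
        proof (intro subsetI PiE_I)
          fix y i assume y: "y \<in> Q" and i: "i \<in> {..<n}"
          then have "y i \<in> {b i ..< b i + side Q0 / 2 ^ j}" "x i \<in> {b i ..< b i + side Q0 / 2 ^ j}"
            using Q(2) unfolding b cube_def by blast+
          then have "dist (y i) (x i) < side Q0 / 2 ^ j" by (auto simp: dist_real_def)
          then show "y i \<in> U i" using j i by blast
        next
          fix y i assume "y \<in> Q" "i \<notin> {..<n}"
          then show "y i = undefined" unfolding b cube_def by (metis PiE_arb)
        qed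
        from subset_trans[OF this U(3)] have "Q \<inter> E = {}" by blast
        then show ?thesis using Q unfolding free_def by (intro bexI[of _ Q] conjI)
      qed
      moreover have "\<not> free 0"
      proof -
        have "card (dyadic_gen n 0 Q0) = 1" using dyadic_gen_card[OF n Q0, of 0] by simp
        then obtain Q where "dyadic_gen n 0 Q0 = {Q}" by (rule card_1_singletonE)
        then have "dyadic_gen n 0 Q0 = {Q0}" using dyadic_gen_Union[OF n Q0, of 0] by simp
        then show ?thesis using meets by (simp add: free_def)
      qed
      ultimately obtain m where m: "free (Suc m)" "\<not> free m"
        using ex_least_nat_less[of free j] by blast
      then obtain Q where Q: "Q \<in> dyadic_gen n (Suc m) Q0" "x \<in> Q" "Q \<inter> E = {}"
        unfolding free_def by blast
      obtain P where P: "P \<in> dyadic_gen n m Q0" "x \<in> P" using gen by blast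
      then have "P \<inter> E \<noteq> {}" using m(2) unfolding free_def by blast
      moreover have "Q \<subseteq> P" using dyadic_gen_nested[OF n Q0 Q(1) P(1)] Q P by auto
      then have "dyadic_parent n Q0 Q = P" using dyadic_parent_eq[OF n Q0 Q(1) P(1)] by blast
      ultimately have "Q \<in> \<D>" using Q unfolding dyadic_exterior_def closure_E by blast
      then show False using x Q by blast
    qed
  qed
qed

lemma exterior_Union:
  assumes "A \<subseteq> \<D>"
  shows "\<Union>A \<in> sets M" "\<Union>A \<subseteq> Q0" "emeasure M (\<Union>A) \<noteq> \<infinity>" "countable A"
proof -
  show "countable A" using assms exterior_countable countable_subset by blast
  have "Q \<in> sets M" if "is_cube n Q" for Q
    using that unfolding is_cube_def by auto
  then show "\<Union>A \<in> sets M"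
    using assms exterior_is_cube \<open>countable A\<close> by (intro sets.countable_Union) auto
  show sub: "\<Union>A \<subseteq> Q0" using assms exterior_subset by blast
  obtain a l where "0 < l" "Q0 = cube n a l" using Q0 unfolding is_cube_def by blast
  then have "emeasure M (\<Union>A) \<le> ennreal (l ^ n)"
    using emeasure_mono[OF sub, of M] by (simp add: emeasure_cube)
  then show "emeasure M (\<Union>A) \<noteq> \<infinity>" by (auto simp: top_unique)
qed

lemma measure_exterior_mono:
  assumes "A \<subseteq> B" "B \<subseteq> \<D>"
  shows "measure M (\<Union>A) \<le> measure M (\<Union>B)"
proof (rule measure_mono_fmeasurable)
  show "\<Union>A \<in> sets M" using assms exterior_Union(1)[of A] by blast
  show "\<Union>B \<in> fmeasurable M"
    using exterior_Union[OF assms(2)] by (auto intro!: fmeasurableI simp: less_top)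
qed (use assms in blast)

section \<open>Attainment of the large and the small scale\<close>

lemma measure_Q0_pos: "0 < measure M Q0"
  using cube_measure[OF Q0] side_pos[OF Q0] by simp

text \<open>By disjointness the sums defining the scales are the proportions of \<open>Q0\<close>
  covered by the cubes. This reduces both scales to monotone functions of a threshold, to which
  continuity of the measure applies.\<close>

lemma le_infsum_exterior_iff:
  assumes "A \<subseteq> \<D>"
  shows "t \<le> (\<Sum>\<^sub>\<infinity>Q\<in>A. measure M Q / measure M Q0) \<longleftrightarrow> t * measure M Q0 \<le> measure M (\<Union>A)"
proof -
  have "disjoint_family_on (\<lambda>Q. Q) A"
    using assms exterior_disjoint unfolding disjoint_family_on_def disjoint_def by blast
  then have "(\<Sum>\<^sub>\<infinity>Q\<in>A. measure M Q) = measure M (\<Union>Q\<in>A. Q)"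
    using exterior_Union[OF assms] exterior_Union(1)[of "{_}"] assms
    by (intro infsum_measure_disjoint) auto
  moreover have "(\<Sum>\<^sub>\<infinity>Q\<in>A. measure M Q / measure M Q0) = (\<Sum>\<^sub>\<infinity>Q\<in>A. measure M Q) / measure M Q0"
    unfolding divide_inverse by (rule infsum_cmult_left')
  ultimately show ?thesis using measure_Q0_pos by (simp add: pos_le_divide_eq)
qed

text \<open>The possible sides of dyadic subcubes. Exterior cubes only have sides
  \<open>gen_side (Suc i)\<close>, so the covered measure is a step function of the threshold and
  both scales are found in this discrete set.\<close>

definition gen_side :: "nat \<Rightarrow> real" where
  "gen_side j = side Q0 / 2 ^ j"

lemma gen_side_pos: "0 < gen_side j"
  using side_pos[OF Q0] by (simp add: gen_side_def)

lemma gen_side_le_iff: "gen_side i \<le> gen_side j \<longleftrightarrow> j \<le> i"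
proof -
  have "gen_side i \<le> gen_side j \<longleftrightarrow> (2::real) ^ j \<le> 2 ^ i"
    using side_pos[OF Q0] by (simp add: gen_side_def field_simps)
  then show ?thesis by simp
qed

lemma gen_side_less_iff: "gen_side i < gen_side j \<longleftrightarrow> j < i"
  using gen_side_le_iff[of j i] by linarith

lemma gen_side_tendsto: "gen_side \<longlonglongrightarrow> 0"
  using tendsto_mult_right[OF LIMSEQ_power_zero[of "1/2::real"], of "side Q0"]
  by (simp add: gen_side_def[abs_def] power_divide)

lemma exterior_side: "Q \<in> \<D> \<Longrightarrow> \<exists>i. side Q = gen_side (Suc i)"
  using exterior_gen dyadic_gen_side_length[OF n Q0] unfolding gen_side_def by blast

abbreviation "larger L \<equiv> {Q \<in> \<D>. L \<le> side Q}"
abbreviation "smaller L \<equiv> {Q \<in> \<D>. side Q \<le> L}"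

lemma measure_larger_tendsto: "(\<lambda>j. measure M (\<Union>(larger (gen_side j)))) \<longlonglongrightarrow> measure M (\<Union>\<D>)"
proof -
  have "(\<Union>j. \<Union>(larger (gen_side j))) = \<Union>\<D>"
    using exterior_side by fastforce
  moreover have "incseq (\<lambda>j. \<Union>(larger (gen_side j)))"
  proof (rule incseq_SucI)
    fix j
    have "gen_side (Suc j) \<le> gen_side j" by (simp add: gen_side_le_iff)
    then show "\<Union>(larger (gen_side j)) \<subseteq> \<Union>(larger (gen_side (Suc j)))" by force
  qed
  moreover have "range (\<lambda>j. \<Union>(larger (gen_side j))) \<subseteq> sets M"
    by (intro image_subsetI exterior_Union(1)) auto
  ultimately show ?thesis
    using Lim_measure_incseq[of "\<lambda>j. \<Union>(larger (gen_side j))" M] exterior_Union(3)[of \<D>] by simp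
qed

text \<open>Continuity from above, with empty intersection: by disjointness a point lies in at most
  one exterior cube, whose side is eventually larger than \<open>gen_side j\<close>.\<close>

lemma measure_smaller_tendsto: "(\<lambda>j. measure M (\<Union>(smaller (gen_side j)))) \<longlonglongrightarrow> 0"
proof -
  have "(\<Inter>j. \<Union>(smaller (gen_side j))) = {}"
  proof (rule ccontr)
    assume "\<not> ?thesis"
    then obtain x where "x \<in> (\<Inter>j. \<Union>(smaller (gen_side j)))" by blast
    then have x: "\<exists>Q\<in>\<D>. x \<in> Q \<and> side Q \<le> gen_side j" for j by blast
    then obtain Q where Q: "Q \<in> \<D>" "x \<in> Q" by blast
    then obtain i where i: "side Q = gen_side (Suc i)" using exterior_side by blast
    obtain Q' where Q': "Q' \<in> \<D>" "x \<in> Q'" "side Q' \<le> gen_side (Suc (Suc i))" using x by blast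
    have "Q' = Q" using exterior_disjoint Q Q' by (meson disjointD disjoint_iff)
    then show False using Q'(3) i by (simp add: gen_side_le_iff)
  qed
  moreover have "decseq (\<lambda>j. \<Union>(smaller (gen_side j)))"
  proof (rule decseq_SucI)
    fix j
    have "gen_side (Suc j) \<le> gen_side j" by (simp add: gen_side_le_iff)
    then show "\<Union>(smaller (gen_side (Suc j))) \<subseteq> \<Union>(smaller (gen_side j))" by force
  qed
  moreover have "range (\<lambda>j. \<Union>(smaller (gen_side j))) \<subseteq> sets M"
    by (intro image_subsetI exterior_Union(1)) auto
  moreover have "emeasure M (\<Union>(smaller (gen_side j))) \<noteq> \<infinity>" for j
    by (rule exterior_Union(3)) blast
  ultimately show ?thesis
    using Lim_measure_decseq[of "\<lambda>j. \<Union>(smaller (gen_side j))" M] by simp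
qed

text \<open>The covered measure tends to that of \<open>Q0\<close>, so it reaches \<open>T\<close>
  at some generation. The first such generation \<open>J\<close> gives the maximum, because a
  threshold above \<open>gen_side J\<close> selects only cubes already selected at an earlier
  generation, where the measure is below \<open>T\<close>. Without attainment
  \<open>GREATEST\<close> would carry no information.\<close>

lemma large_scale_attained:
  assumes full: "measure M (\<Union>\<D>) = measure M Q0" and t: "0 < t" "t < 1"
  shows "0 < large_scale n E Q0 t"
    and "t * measure M Q0 \<le> measure M (\<Union>(larger (large_scale n E Q0 t)))"
proof -
  define m where "m L = measure M (\<Union>(larger L))" for L
  define T where "T = t * measure M Q0"
  have T: "0 < T" "T < measure M Q0" using t measure_Q0_pos by (simp_all add: T_def)
  have "\<forall>\<^sub>F j in sequentially. T < m (gen_side j)"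
    using order_tendstoD(1)[OF measure_larger_tendsto] full T(2) unfolding m_def by simp
  then have ex: "\<exists>j. T \<le> m (gen_side j)"
    by (auto simp: eventually_sequentially dest: less_imp_le)
  define J where "J = (LEAST j. T \<le> m (gen_side j))"
  have J: "T \<le> m (gen_side J)" unfolding J_def using ex by (rule LeastI_ex)
  have least: "\<not> T \<le> m (gen_side j)" if "j < J" for j
    using that not_less_Least unfolding J_def by blast
  have "large_scale n E Q0 t = (GREATEST L. 0 \<le> L \<and> T \<le> m L)"
    unfolding large_scale_def m_def T_def by (subst le_infsum_exterior_iff) auto
  also have "\<dots> = gen_side J"
  proof (rule Greatest_equality)
    show "0 \<le> gen_side J \<and> T \<le> m (gen_side J)" using J gen_side_pos[of J] by simp
  next
    fix y assume y: "0 \<le> y \<and> T \<le> m y"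
    show "y \<le> gen_side J"
    proof (rule ccontr)
      assume *: "\<not> y \<le> gen_side J"
      \<comment> \<open>A cube selected by \<open>y\<close> has side at least \<open>y\<close>,
        hence strictly above \<open>gen_side J\<close>. For \<open>J = 0\<close> this excludes every
        cube, and the covered measure 0 contradicts \<open>0 < T\<close>.\<close>
      have le: "Suc i < J" if "y \<le> gen_side (Suc i)" for i
        using that * gen_side_less_iff[of J "Suc i"] by linarith
      show False
      proof (cases J)
        case 0
        then have "larger y = {}" using le exterior_side by fastforce
        then have "m y = 0" unfolding m_def by (simp only: Union_empty measure_empty)
        then show False using y T by simp
      next
        case (Suc J')
        have "larger y \<subseteq> larger (gen_side J')"
        proof clarify
          fix Q assume Q: "Q \<in> \<D>" "y \<le> side Q"
          then obtain i where i: "side Q = gen_side (Suc i)" using exterior_side by blast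
          then show "gen_side J' \<le> side Q" using le[of i] Q Suc by (simp add: gen_side_le_iff)
        qed
        then have "m y \<le> m (gen_side J')" unfolding m_def by (intro measure_exterior_mono) auto
        then show False using least[of J'] y Suc by simp
      qed
    qed
  qed
  finally have "large_scale n E Q0 t = gen_side J" .
  then show "0 < large_scale n E Q0 t"
    and "t * measure M Q0 \<le> measure M (\<Union>(larger (large_scale n E Q0 t)))"
    using J gen_side_pos by (simp_all add: m_def T_def)
qed

text \<open>At generation 0 every exterior cube is counted and the measure is full, while it tends
  to 0 along the generations. The minimum is the side at the last generation \<open>J\<close> before
  the measure first drops below \<open>T\<close>; a threshold below \<open>gen_side J\<close> only
  selects cubes with side at most \<open>gen_side (Suc J)\<close>.\<close>

lemma small_scale_attained:
  assumes full: "measure M (\<Union>\<D>) = measure M Q0" and t: "0 < t" "t < 1"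
  shows "0 < small_scale n E Q0 t"
    and "t * measure M Q0 \<le> measure M (\<Union>(smaller (small_scale n E Q0 t)))"
proof -
  define m where "m L = measure M (\<Union>(smaller L))" for L
  define T where "T = t * measure M Q0"
  have T: "0 < T" "T < measure M Q0" using t measure_Q0_pos by (simp_all add: T_def)
  have "\<forall>\<^sub>F j in sequentially. m (gen_side j) < T"
    using order_tendstoD(2)[OF measure_smaller_tendsto T(1)] unfolding m_def by simp
  then have ex: "\<exists>j. m (gen_side j) < T" by (auto simp: eventually_sequentially)
  have "smaller (gen_side 0) = \<D>" using exterior_side gen_side_le_iff by fastforce
  then have "\<not> m (gen_side 0) < T" using full T by (simp add: m_def)
  then obtain J where J: "\<not> m (gen_side J) < T" "m (gen_side (Suc J)) < T"
    using ex ex_least_nat_less[of "\<lambda>j. m (gen_side j) < T"] by blast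
  have "small_scale n E Q0 t = (LEAST L. 0 \<le> L \<and> T \<le> m L)"
    unfolding small_scale_def m_def T_def by (subst le_infsum_exterior_iff) auto
  also have "\<dots> = gen_side J"
  proof (rule Least_equality)
    show "0 \<le> gen_side J \<and> T \<le> m (gen_side J)" using J gen_side_pos[of J] by simp
  next
    fix y assume y: "0 \<le> y \<and> T \<le> m y"
    show "gen_side J \<le> y"
    proof (rule ccontr)
      assume *: "\<not> gen_side J \<le> y"
      have "smaller y \<subseteq> smaller (gen_side (Suc J))"
      proof clarify
        fix Q assume Q: "Q \<in> \<D>" "side Q \<le> y"
        then obtain i where i: "side Q = gen_side (Suc i)" using exterior_side by blast
        then have "J < Suc i" using Q * gen_side_less_iff[of "Suc i" J] by linarith
        then show "side Q \<le> gen_side (Suc J)" using i by (simp add: gen_side_le_iff)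
      qed
      then have "m y \<le> m (gen_side (Suc J))" unfolding m_def by (intro measure_exterior_mono) auto
      then show False using J y by simp
    qed
  qed
  finally have "small_scale n E Q0 t = gen_side J" .
  then show "0 < small_scale n E Q0 t"
    and "t * measure M Q0 \<le> measure M (\<Union>(smaller (small_scale n E Q0 t)))"
    using J gen_side_pos by (simp_all add: m_def T_def)
qed

end

section \<open>Distance weights\<close>

lemma abs_diff_le_Rn_dist:
  assumes "i < n"
  shows "\<bar>x i - y i\<bar> \<le> Rn_dist n x y"
proof -
  have "(x i - y i)\<^sup>2 \<le> (\<Sum>i<n. (x i - y i)\<^sup>2)"
    using assms by (intro member_le_sum) auto
  then have "sqrt ((x i - y i)\<^sup>2) \<le> sqrt (\<Sum>i<n. (x i - y i)\<^sup>2)" by (rule real_sqrt_le_mono)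
  then show ?thesis by (simp add: Rn_dist_def L2_set_def)
qed

lemma Rn_dist_le_cube:
  assumes "x \<in> cube n a l" "y \<in> cube n a l"
  shows "Rn_dist n x y \<le> real n * l"
proof -
  have "Rn_dist n x y \<le> (\<Sum>i<n. \<bar>x i - y i\<bar>)"
    unfolding Rn_dist_def by (rule L2_set_le_sum_abs)
  also have "\<dots> \<le> real (card {..<n}) * l"
  proof (rule sum_bounded_above)
    fix i assume "i \<in> {..<n}"
    then have "x i \<in> {a i ..< a i + l}" "y i \<in> {a i ..< a i + l}"
      using assms unfolding cube_def by blast+
    then show "\<bar>x i - y i\<bar> \<le> l" by auto
  qed
  finally show ?thesis by simp
qed

text \<open>Some coordinate of \<open>y\<close> leaves its interval, and the same coordinate of
  \<open>x\<close> stays \<open>l / 4\<close> away from both ends.\<close>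

lemma Rn_dist_middle_ge:
  assumes x: "x \<in> cube n (\<lambda>i. a i + l / 4) (l / 2)" and y: "y \<in> Rn n" "y \<notin> cube n a l"
  shows "l / 4 \<le> Rn_dist n x y"
proof -
  have "\<exists>i<n. y i \<notin> {a i ..< a i + l}"
  proof (rule ccontr)
    assume "\<not> ?thesis"
    then have "y \<in> cube n a l"
      using y(1) by (simp add: cube_def Rn_def PiE_iff)
    then show False using y(2) by blast
  qed
  then obtain i where i: "i < n" "y i \<notin> {a i ..< a i + l}" by blast
  have "i \<in> {..<n}" using i by simp
  then have "x i \<in> {a i + l / 4 ..< a i + l / 4 + l / 2}"
    using x unfolding cube_def by blast
  then have "l / 4 \<le> \<bar>x i - y i\<bar>" using i(2) by auto
  also have "\<dots> \<le> Rn_dist n x y" using i(1) by (rule abs_diff_le_Rn_dist)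
  finally show ?thesis .
qed

lemma Rn_dist_nonneg: "0 \<le> Rn_dist n x y"
  by (simp add: Rn_dist_def)

lemma dist_to_set_le: "e \<in> E \<Longrightarrow> dist_to_set n E x \<le> Rn_dist n x e"
  unfolding dist_to_set_def
  by (rule cINF_lower) (auto intro!: bdd_belowI[of _ 0] simp: Rn_dist_nonneg)

lemma dist_to_set_nonneg: "E \<noteq> {} \<Longrightarrow> 0 \<le> dist_to_set n E x"
  unfolding dist_to_set_def by (rule cINF_greatest) (auto simp: Rn_dist_nonneg)

lemma ennreal_powr_ge:
  assumes "0 < s" "0 < c" "ennreal c \<le> x"
  shows "ennreal (c powr s) \<le> ennreal_powr x s"
proof (cases x)
  case (real r)
  then have "c \<le> r" using assms by simp
  then show ?thesis
    using assms real by (auto simp: ennreal_powr_def intro!: ennreal_leI powr_mono2)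
next
  case top
  then show ?thesis using assms by (simp add: ennreal_powr_def)
qed

lemma dist_weight_at: "E \<noteq> {} \<Longrightarrow> 0 < \<alpha> \<Longrightarrow> x \<in> E \<Longrightarrow> dist_weight n E \<alpha> x = \<infinity>"
  using dist_to_set_le[of x E n x] dist_to_set_nonneg[of E n x]
  by (simp add: dist_weight_def ennreal_powr_def Rn_dist_def L2_set_def)

lemma dist_weight_ge:
  assumes "E \<noteq> {}" "0 < \<alpha>" "dist_to_set n E x \<le> d"
  shows "ennreal (d powr - \<alpha>) \<le> dist_weight n E \<alpha> x"
proof (cases "dist_to_set n E x = 0")
  case True
  then show ?thesis using assms by (simp add: dist_weight_def ennreal_powr_def)
next
  case False
  then have "0 < dist_to_set n E x" using dist_to_set_nonneg[OF assms(1), of n x] by simp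
  then show ?thesis
    using assms by (auto simp: dist_weight_def ennreal_powr_def intro!: ennreal_leI powr_mono2')
qed

text \<open>The dual weight is dist^(\<alpha>/(p-1)), a positive power, so it is large away from
  \<open>E\<close>. Positivity of \<open>d\<close> keeps the conversion within finite real
  powers.\<close>

lemma dual_dist_weight_ge:
  assumes "0 < \<alpha>" "1 < p" "0 < d" "d \<le> dist_to_set n E x"
  shows "ennreal (d powr (\<alpha> / (p - 1))) \<le> ennreal_powr (dist_weight n E \<alpha> x) (- 1 / (p - 1))"
proof -
  let ?D = "dist_to_set n E x"
  have D: "0 < ?D" using assms by simp
  then have w: "dist_weight n E \<alpha> x = ennreal (?D powr - \<alpha>)"
    using assms by (simp add: dist_weight_def ennreal_powr_def)
  have "- 1 / (p - 1) \<noteq> 0" using assms by simp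
  then have "ennreal_powr (dist_weight n E \<alpha> x) (- 1 / (p - 1)) = ennreal ((?D powr - \<alpha>) powr (- 1 / (p - 1)))"
    unfolding w ennreal_powr_def using D by simp
  also have "\<dots> = ennreal (?D powr (\<alpha> / (p - 1)))" by (simp add: powr_powr)
  finally show ?thesis
    using assms by (simp add: powr_mono2 ennreal_leI)
qed

text \<open>Since \<^const>\<open>Ap_bound\<close> only admits positive constants, the \<open>LEAST\<close> in \<^const>\<open>Ap_constant\<close> would be
  junk if the bounds accumulated at \<open>0\<close>.\<close>

lemma Ap_bound_Ap_constant:
  assumes ex: "Ap_bound n p w C" and \<delta>: "0 < \<delta>" "\<And>C. Ap_bound n p w C \<Longrightarrow> \<delta> \<le> C"
  shows "Ap_bound n p w (Ap_constant n p w)"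
proof -
  define S where "S = {C. Ap_bound n p w C}"
  define K where "K = Inf S"
  have S: "S \<noteq> {}" "bdd_below S" using ex \<delta>(2) by (auto simp: S_def intro!: bdd_belowI[of _ \<delta>])
  \<comment> \<open>The uniform lower bound \<open>\<delta>\<close> passes to the infimum, which is
    what makes it admissible in \<open>Ap_bound\<close>.\<close>
  have K: "0 < K" using \<delta> S(1) cInf_greatest[of S \<delta>] by (auto simp: K_def S_def)
  have "Ap_bound n p w K"
    unfolding Ap_bound_def
  proof (intro conjI allI impI)
    fix Q assume Q: "is_cube n Q"
    let ?a = "average n Q w * ennreal_powr (average n Q (\<lambda>x. ennreal_powr (w x) (- 1 / (p - 1)))) (p - 1)"
    have le: "?a \<le> ennreal C" if "C \<in> S" for C
      using that Q by (simp add: S_def Ap_bound_def)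
    then have "?a \<noteq> \<infinity>" using S(1) by (metis ennreal_less_top equals0I infinity_ennreal_def leD top.extremum_strict)
    then obtain r where r: "0 \<le> r" "?a = ennreal r" by (metis ennreal_cases infinity_ennreal_def)
    have "r \<le> C" if "C \<in> S" for C
      using le[OF that] r that by (auto simp: S_def Ap_bound_def)
    then have "r \<le> K" unfolding K_def using S(1) by (intro cInf_greatest)
    then show "?a \<le> ennreal K" unfolding r(2) by (rule ennreal_leI)
  qed (rule K)
  moreover have "K \<le> C" if "Ap_bound n p w C" for C
    unfolding K_def using that S(2) by (intro cInf_lower) (auto simp: S_def)
  ultimately have "Ap_constant n p w = K"
    unfolding Ap_constant_def by (rule Least_equality)
  with \<open>Ap_bound n p w K\<close> show ?thesis by simp
qed

section \<open>Lower bounds for the two averages over \<open>Q0\<close>\<close>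

context exterior_cubes
begin

text \<open>The weight is infinite on \<open>E\<close> yet integrable over a compact set containing
  \<open>Q0\<close>, so the part of \<open>Q0\<close> in \<open>E\<close> is null; the exterior
  cubes cover the rest.\<close>

lemma measure_exterior_full:
  assumes w: "weight n (dist_weight n E \<alpha>)" and \<alpha>: "0 < \<alpha>"
  shows "measure M (\<Union>\<D>) = measure M Q0"
proof -
  define N where "N = Q0 \<inter> E"
  obtain a l where al: "0 < l" "Q0 = cube n a l" using Q0 unfolding is_cube_def by blast
  then have "Q0 \<in> sets M" by simp
  \<comment> \<open>Measurability comes from writing \<open>N\<close> as \<open>Q0\<close> minus a
    countable union of cubes, with no comparison of the topology and the product
    sigma-algebra.\<close>
  then have N: "N \<in> sets M"
    unfolding N_def exterior_covers[symmetric] using exterior_Union(1)[of \<D>] by blast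
  obtain K where K: "compactin (Rn_topology n) K" "Q0 \<subseteq> K"
    using cube_subset_compact[of n a l] al by blast
  have w_E: "dist_weight n E \<alpha> x = \<infinity>" if "x \<in> E" for x
    using that \<alpha> by (intro dist_weight_at) auto
  have "\<infinity> * emeasure M N = (\<integral>\<^sup>+x. \<infinity> * indicator N x \<partial>M)"
    using N by (simp add: nn_integral_cmult_indicator)
  also have "\<dots> \<le> (\<integral>\<^sup>+x\<in>K. dist_weight n E \<alpha> x \<partial>M)"
    using K(2) by (intro nn_integral_mono) (auto simp: N_def indicator_def w_E)
  also have "\<dots> < \<infinity>" using w K(1) unfolding weight_def by blast
  finally have "emeasure M N = 0" by (auto simp: ennreal_top_mult split: if_splits)
  then have "N \<in> null_sets M" using N by (simp add: null_sets_def)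
  moreover have "Q0 = \<Union>\<D> \<union> N"
    using exterior_covers exterior_Union(2)[of \<D>] unfolding N_def by blast
  ultimately show ?thesis using measure_Un_null_set[of "\<Union>\<D>" M N] exterior_Union(1)[of \<D>] by simp
qed

lemma average_dist_weight_ge:
  assumes \<alpha>: "0 < \<alpha>" and S: "0 < S" and t: "0 < t"
    and big: "t * measure M Q0 \<le> measure M (\<Union>(smaller S))"
  shows "ennreal (t * (2 * real n * S) powr - \<alpha>) \<le> average n Q0 (dist_weight n E \<alpha>)"
proof (rule average_ge[OF Q0 _ _ big])
  show "\<Union>(smaller S) \<in> sets M" "\<Union>(smaller S) \<subseteq> Q0"
    using exterior_Union(1,2)[of "smaller S"] by auto
  fix x assume "x \<in> \<Union>(smaller S)"
  then obtain Q where Q: "Q \<in> \<D>" "side Q \<le> S" "x \<in> Q" by blast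
  from Q(1) obtain j P where P: "Q \<in> dyadic_gen n (Suc j) Q0" "P \<in> dyadic_gen n j Q0" "Q \<subseteq> P"
    "Q \<inter> E = {}" "P \<inter> E \<noteq> {}" "is_cube n Q" "side Q = side Q0 / 2 ^ Suc j"
    "is_cube n P" "side P = 2 * side Q"
    by (rule exteriorE)
  then obtain e where e: "e \<in> P" "e \<in> E" by blast
  obtain b where b: "P = cube n b (side P)" using cube_side[OF P(8)] by blast
  have "x \<in> cube n b (side P)" "e \<in> cube n b (side P)" using P(3) Q(3) e(1) b by auto
  then have "Rn_dist n x e \<le> real n * side P" by (rule Rn_dist_le_cube)
  \<comment> \<open>The factor 2 is the passage from \<open>Q\<close> to its parent, and
    \<open>n\<close> is the crude bound for the diameter of the unit cube.\<close>
  also have "\<dots> \<le> real n * (2 * S)" using Q(2) P(9) by (intro mult_left_mono) auto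
  finally have "dist_to_set n E x \<le> 2 * real n * S" using dist_to_set_le[OF e(2), of n x] by simp
  then show "ennreal ((2 * real n * S) powr - \<alpha>) \<le> dist_weight n E \<alpha> x"
    using \<alpha> e by (intro dist_weight_ge) auto
qed (use t in auto)

lemma average_dual_dist_weight_ge:
  assumes \<alpha>: "0 < \<alpha>" and p: "1 < p" and L: "0 < L" and t: "0 < t"
    and big: "t * measure M Q0 \<le> measure M (\<Union>(larger L))"
  shows "ennreal (t / 2 ^ n * (L / 4) powr (\<alpha> / (p - 1)))
    \<le> average n Q0 (\<lambda>x. ennreal_powr (dist_weight n E \<alpha> x) (- 1 / (p - 1)))"
proof -
  have "\<forall>Q. \<exists>a. is_cube n Q \<longrightarrow> Q = cube n a (side Q)" using cube_side by blast
  then obtain c where c: "\<And>Q. is_cube n Q \<Longrightarrow> Q = cube n (c Q) (side Q)" by metis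
  \<comment> \<open>Points of \<open>Q\<close> may be arbitrarily close to \<open>E\<close>, so each
    cube is shrunk to its concentric half. This costs the factor 2^(-n) in measure and gains the
    distance bound.\<close>
  define mid where "mid Q = cube n (\<lambda>i. c Q i + side Q / 4) (side Q / 2)" for Q
  have mid_sub: "mid Q \<subseteq> Q" if "is_cube n Q" for Q
  proof -
    have "mid Q \<subseteq> cube n (c Q) (side Q)"
      using side_pos[OF that] unfolding mid_def cube_def by (intro PiE_mono) auto
    then show ?thesis using c[OF that] by simp
  qed
  have mid_measure: "measure M (mid Q) = measure M Q * (1 / 2 ^ n)" if "is_cube n Q" for Q
    using side_pos[OF that] cube_measure[OF that] by (simp add: mid_def measure_cube power_divide)
  define V where "V = (\<Union>Q\<in>larger L. mid Q)"
  have A: "larger L \<subseteq> \<D>" by blast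
  have V: "V \<in> sets M"
    unfolding V_def using exterior_Union(4)[OF A] by (intro sets.countable_UN') (auto simp: mid_def)
  have VU: "V \<subseteq> \<Union>(larger L)"
    unfolding V_def using mid_sub exterior_is_cube by blast
  have disj: "disjoint_family_on (\<lambda>Q. Q) (larger L)"
    using exterior_disjoint unfolding disjoint_family_on_def disjoint_def by blast
  have "measure M V = (\<Sum>\<^sub>\<infinity>Q\<in>larger L. measure M (mid Q))"
    unfolding V_def
  proof (rule infsum_measure_disjoint[symmetric])
    show "countable (larger L)" by (rule exterior_Union(4)[OF A])
    show "mid Q \<in> sets M" for Q by (simp add: mid_def)
    show "disjoint_family_on mid (larger L)"
      unfolding disjoint_family_on_def
    proof (intro ballI impI)
      fix P Q assume PQ: "P \<in> larger L" "Q \<in> larger L" "P \<noteq> Q"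
      then have "P \<inter> Q = {}" using disj by (simp add: disjoint_family_on_def)
      moreover have "mid P \<subseteq> P" "mid Q \<subseteq> Q" using PQ mid_sub exterior_is_cube by auto
      ultimately show "mid P \<inter> mid Q = {}" by blast
    qed
    have "emeasure M V \<le> emeasure M (\<Union>(larger L))"
      using VU exterior_Union(1)[OF A] by (rule emeasure_mono)
    then show "emeasure M (\<Union>Q\<in>larger L. mid Q) \<noteq> \<infinity>"
      using exterior_Union(3)[OF A] unfolding V_def by (auto simp: top_unique)
  qed
  also have "\<dots> = (\<Sum>\<^sub>\<infinity>Q\<in>larger L. measure M Q * (1 / 2 ^ n))"
    using exterior_is_cube by (intro infsum_cong mid_measure) auto
  also have "\<dots> = (\<Sum>\<^sub>\<infinity>Q\<in>larger L. measure M Q) * (1 / 2 ^ n)" by (rule infsum_cmult_left')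
  also have "(\<Sum>\<^sub>\<infinity>Q\<in>larger L. measure M Q) = measure M (\<Union>Q\<in>larger L. Q)"
    using exterior_Union[OF A] exterior_Union(1)[of "{_}"] disj
    by (intro infsum_measure_disjoint) auto
  finally have "measure M V = measure M (\<Union>(larger L)) / 2 ^ n" by simp
  then have mV: "t / 2 ^ n * measure M Q0 \<le> measure M V" using big by (simp add: divide_right_mono)
  show ?thesis
  proof (rule average_ge[OF Q0 V _ mV])
    show "V \<subseteq> Q0" using VU exterior_Union(2)[OF A] by blast
    fix x assume "x \<in> V"
    then obtain Q where Q: "Q \<in> \<D>" "L \<le> side Q" "x \<in> mid Q" unfolding V_def by blast
    have "L / 4 \<le> Rn_dist n x e" if e: "e \<in> E" for e
    proof -
      have "e \<in> Rn n" using e closedin_subset[OF E] by (auto simp: topspace_Rn_topology)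
      moreover have "e \<notin> cube n (c Q) (side Q)"
        using exterior_free[OF Q(1)] e c[OF exterior_is_cube[OF Q(1)]] by blast
      ultimately have "side Q / 4 \<le> Rn_dist n x e" using Q(3) unfolding mid_def by (rule Rn_dist_middle_ge[rotated])
      then show ?thesis using Q(2) by simp
    qed
    then have "L / 4 \<le> dist_to_set n E x"
      unfolding dist_to_set_def using meets by (intro cINF_greatest) auto
    then show "ennreal ((L / 4) powr (\<alpha> / (p - 1))) \<le> ennreal_powr (dist_weight n E \<alpha> x) (- 1 / (p - 1))"
      using L by (intro dual_dist_weight_ge[OF \<alpha> p]) auto
  qed (use t in auto)
qed

text \<open>The two averages multiplied on the single cube \<open>Q0\<close>. The bound is kept for
  every admissible \<open>C\<close>, since it must also show that the \<open>A_p\<close> bounds stay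
  away from 0.\<close>

lemma Ap_bound_ge:
  assumes \<alpha>: "0 < \<alpha>" and p: "1 < p" and L: "0 < L" and S: "0 < S" and t: "0 < t"
    and "t * measure M Q0 \<le> measure M (\<Union>(larger L))" "t * measure M Q0 \<le> measure M (\<Union>(smaller S))"
    and C: "Ap_bound n p (dist_weight n E \<alpha>) C"
  shows "t * (2 * real n * S) powr - \<alpha> * (t / 2 ^ n * (L / 4) powr (\<alpha> / (p - 1))) powr (p - 1) \<le> C"
proof -
  let ?X = "t * (2 * real n * S) powr - \<alpha>"
  let ?Y = "t / 2 ^ n * (L / 4) powr (\<alpha> / (p - 1))"
  have X: "0 \<le> ?X" and Y: "0 < ?Y" using t L by simp_all
  have "ennreal (?X * ?Y powr (p - 1)) = ennreal ?X * ennreal (?Y powr (p - 1))"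
    using X by (simp add: ennreal_mult)
  also have "\<dots> \<le> average n Q0 (dist_weight n E \<alpha>) *
      ennreal_powr (average n Q0 (\<lambda>x. ennreal_powr (dist_weight n E \<alpha> x) (- 1 / (p - 1)))) (p - 1)"
    using assms Y by (intro mult_mono average_dist_weight_ge ennreal_powr_ge average_dual_dist_weight_ge) auto
  also have "\<dots> \<le> ennreal C" using C Q0 unfolding Ap_bound_def by blast
  finally show ?thesis using C by (simp add: Ap_bound_def)
qed

end

text \<open>With \<open>R = (L / 4) / (2 n S)\<close>, the two powers of the scales combine to
  R^\<alpha> and the two powers of \<open>t\<close> to t^p. Taking the root of order \<alpha> leaves
  t^(p/\<alpha>).\<close>

lemma scale_ratio_le:
  fixes L S t \<alpha> p C :: real
  assumes pos: "0 < L" "0 < S" "0 < t" "0 < \<alpha>" "1 < p" "0 < C" "0 < n"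
    and le: "t * (2 * real n * S) powr - \<alpha> * (t / 2 ^ n * (L / 4) powr (\<alpha> / (p - 1))) powr (p - 1) \<le> C"
  shows "L \<le> 8 * real n * (C * 2 powr (real n * (p - 1))) powr (1 / \<alpha>) / t powr (p / \<alpha>) * S"
proof -
  define R where "R = L / (8 * real n * S)"
  define B where "B = C * 2 powr (real n * (p - 1))"
  have R: "0 < R" and B: "0 < B" using pos by (simp_all add: R_def B_def)
  have "(t / 2 ^ n * (L / 4) powr (\<alpha> / (p - 1))) powr (p - 1)
      = t powr (p - 1) / 2 powr (real n * (p - 1)) * (L / 4) powr \<alpha>"
    using pos by (simp add: powr_mult powr_divide powr_powr powr_realpow[symmetric])
  moreover have "R powr \<alpha> = (L / 4) powr \<alpha> * (2 * real n * S) powr - \<alpha>"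
  proof -
    have "R = (L / 4) / (2 * real n * S)" by (simp add: R_def)
    then have "R powr \<alpha> = (L / 4) powr \<alpha> / (2 * real n * S) powr \<alpha>"
      using pos powr_divide[of "L / 4" "2 * real n * S" \<alpha>] by simp
    then show ?thesis by (simp only: powr_minus divide_inverse)
  qed
  moreover have "t powr p = t * t powr (p - 1)"
    using pos powr_add[of t 1 "p - 1"] by simp
  ultimately have "t powr p / 2 powr (real n * (p - 1)) * R powr \<alpha> \<le> C"
    using le by (simp add: mult_ac)
  moreover have "r \<le> C * d / x" if "x / d * r \<le> C" "0 < d" "0 < x" for x d r :: real
    using that by (simp add: field_simps)
  ultimately have "R powr \<alpha> \<le> B / t powr p" unfolding B_def using pos by simp
  then have "(R powr \<alpha>) powr (1 / \<alpha>) \<le> (B / t powr p) powr (1 / \<alpha>)"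
    using pos by (intro powr_mono2) auto
  then have "R \<le> B powr (1 / \<alpha>) / t powr (p / \<alpha>)"
    using pos R B by (simp add: powr_powr powr_divide)
  then have "R * (8 * real n * S) \<le> B powr (1 / \<alpha>) / t powr (p / \<alpha>) * (8 * real n * S)"
    using pos by (intro mult_right_mono) auto
  then show ?thesis using pos by (simp add: R_def B_def mult_ac)
qed

theorem theorem4p1:
  shows "\<exists>(\<sigma> :: real \<Rightarrow> real \<Rightarrow> real) (C\<^sub>0 :: nat \<Rightarrow> real \<Rightarrow> real \<Rightarrow> real \<Rightarrow> real).
    (\<forall>\<alpha> p. 0 < \<sigma> \<alpha> p) \<and> (\<forall>n \<alpha> p K. 0 < C\<^sub>0 n \<alpha> p K) \<and>
    (\<forall>(n::nat) E \<alpha> p.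
       1 \<le> n \<longrightarrow> closedin (Rn_topology n) E \<longrightarrow> E \<noteq> {} \<longrightarrow>
       0 < \<alpha> \<longrightarrow> 1 < p \<longrightarrow> Ap_weight n p (dist_weight n E \<alpha>) \<longrightarrow>
       (\<forall>Q\<^sub>0 t. is_cube n Q\<^sub>0 \<longrightarrow> Q\<^sub>0 \<inter> E \<noteq> {} \<longrightarrow> 0 < t \<longrightarrow> t < 1 \<longrightarrow>
          large_scale n E Q\<^sub>0 t
            \<le> C\<^sub>0 n \<alpha> p (Ap_constant n p (dist_weight n E \<alpha>)) / t powr \<sigma> \<alpha> p * small_scale n E Q\<^sub>0 t))"
proof -
  \<comment> \<open>Positivity is claimed for all real arguments, so a default 1 covers those where
    p/\<alpha> is not positive. Likewise \<open>real n + 1\<close> and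
    \<open>\<bar>K\<bar> + 1\<close> keep \<open>C0\<close> positive everywhere and only enlarge the
    bound obtained.\<close>
  define \<sigma> where "\<sigma> \<alpha> p = (if 0 < p / \<alpha> then p / \<alpha> else 1)" for \<alpha> p :: real
  define C0 where "C0 n \<alpha> p K =
    8 * (real n + 1) * ((\<bar>K\<bar> + 1) * 2 powr (real n * (p - 1))) powr (1 / \<alpha>)" for n :: nat and \<alpha> p K :: real
  have "large_scale n E Q0 t
      \<le> C0 n \<alpha> p (Ap_constant n p (dist_weight n E \<alpha>)) / t powr \<sigma> \<alpha> p * small_scale n E Q0 t"
    if n: "1 \<le> n" and E: "closedin (Rn_topology n) E" and \<alpha>: "0 < \<alpha>" and p: "1 < p"
      and w: "Ap_weight n p (dist_weight n E \<alpha>)"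
      and Q0: "is_cube n Q0" "Q0 \<inter> E \<noteq> {}" and t: "0 < t" "t < 1"
    for n E \<alpha> p Q0 t
  proof -
    interpret exterior_cubes n E Q0 using n E Q0 by unfold_locales auto
    define L where "L = large_scale n E Q0 t"
    define S where "S = small_scale n E Q0 t"
    define K where "K = Ap_constant n p (dist_weight n E \<alpha>)"
    have "measure (Rn_lebesgue n) (\<Union>\<D>) = measure (Rn_lebesgue n) Q0"
      using w \<alpha> measure_exterior_full unfolding Ap_weight_def by blast
    note scales = large_scale_attained[OF this t, folded L_def] small_scale_attained[OF this t, folded S_def]
    \<comment> \<open>A positive number below every \<open>A_p\<close> bound of the weight: it first
      serves as \<open>\<delta>\<close>, so that \<open>K\<close> is itself a bound, and is then
      compared with \<open>K\<close>.\<close>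
    define X where "X = t * (2 * real n * S) powr - \<alpha> * (t / 2 ^ n * (L / 4) powr (\<alpha> / (p - 1))) powr (p - 1)"
    have X: "0 < X" using scales t n by (simp add: X_def)
    have X_le: "X \<le> C" if "Ap_bound n p (dist_weight n E \<alpha>) C" for C
      unfolding X_def using scales t that by (intro Ap_bound_ge \<alpha> p) auto
    obtain C where "Ap_bound n p (dist_weight n E \<alpha>) C" using w unfolding Ap_weight_def by blast
    then have bound: "Ap_bound n p (dist_weight n E \<alpha>) K"
      unfolding K_def using X X_le by (rule Ap_bound_Ap_constant)
    then have K: "0 < K" by (simp add: Ap_bound_def)
    have "L \<le> 8 * real n * (K * 2 powr (real n * (p - 1))) powr (1 / \<alpha>) / t powr (p / \<alpha>) * S"
      using scales t \<alpha> p K n X_le[OF bound] unfolding X_def by (intro scale_ratio_le) auto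
    also have "\<dots> \<le> C0 n \<alpha> p K / t powr (p / \<alpha>) * S"
      unfolding C0_def using scales K \<alpha> t
      by (intro mult_right_mono divide_right_mono mult_mono powr_mono2) auto
    finally show ?thesis using \<alpha> p by (simp add: L_def S_def K_def \<sigma>_def)
  qed
  moreover have "0 < \<sigma> \<alpha> p" for \<alpha> p by (simp add: \<sigma>_def)
  moreover have "0 < C0 n \<alpha> p K" for n \<alpha> p K
  proof -
    have "0 < \<bar>K\<bar> + 1" by linarith
    then show ?thesis by (simp add: C0_def)
  qed
  ultimately show ?thesis by (intro exI[of _ \<sigma>] exI[of _ C0] conjI allI impI)
qed

end
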